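(* Let $\mathbb{F}$ be an algebraically closed field of characteristic zero and let $\alpha\in\mathbb{F}$. The algebra $\mathcal{A}=\mathbf{D}_3(\alpha,-\alpha-2)$ is a simple algebra with trivial automorphism group, and the Artin–Procesi–Iltyakov Equality does not hold for $\mathcal{A}^m$, i.e. $I_m(\mathcal{A})\neq\mathrm{Tr}(\mathcal{A})_m$, for all $m>0$.
   Context: $\mathbf{D}_3(\alpha,\beta)$ is the two-dimensional $\mathbb{F}$-algebra with basis $e_1,e_2$ and products $e_1e_1=e_1$, $e_1e_2=e_1+\alpha e_2$, $e_2e_1=-e_1+\beta e_2$, $e_2e_2=0$. An algebra is a vector space with a bilinear multiplication, not necessarily associative; it is simple if its multiplication is not identically zero and it has no two-sided ideals other than $0$ and itself. For an $n$-dimensional algebra $\mathcal{A}$ over $\mathbb{F}$ with a fixed basis, $\mathbb{F}[\mathcal{A}^m]=\mathbb{F}[x_{ri}:1\leqslant r\leqslant m,1\leqslant i\leqslant n]$ is the algebra of polynomial functions on $\mathcal{A}^m$, where $x_{ri}(a_1,\ldots,a_m)$ is the $i$-th coordinate of $a_r$. The group $\mathrm{Aut}(\mathcal{A})$ of algebra automorphisms acts diagonally on $\mathcal{A}^m$ and $I_m(\mathcal{A})=\{f\in\mathbb{F}[\mathcal{A}^m]: f(g\cdot\underline{a})=f(\underline{a})\ \text{for all } g\in\mathrm{Aut}(\mathcal{A}),\ \underline{a}\in\mathcal{A}^m\}$. Operator traces: let $\mathbb{F}\langle\chi_0,\ldots,\chi_m\rangle$ be the absolutely free (non-associative) unital algebra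 in letters $\chi_0,\ldots,\chi_m$. If $h\in\mathbb{F}\langle\chi_0,\ldots,\chi_m\rangle$ is homogeneous of degree $1$ in $\chi_0$ (each monomial of $h$ contains $\chi_0$ exactly once), then for $\underline{a}=(a_1,\ldots,a_m)\in\mathcal{A}^m$ let $h(\,\cdot\,,\underline{a}):\mathcal{A}\to\mathcal{A}$ be the linear operator $b\mapsto h(b,a_1,\ldots,a_m)$ (substitute $\chi_0\to b$, $\chi_r\to a_r$). The operator trace $\mathrm{tr}(h):\mathcal{A}^m\to\mathbb{F}$ is $\mathrm{tr}(h)(\underline{a})=\mathrm{tr}(h(\,\cdot\,,\underline{a}))$; it lies in $I_m(\mathcal{A})$. $\mathrm{Tr}(\mathcal{A})_m$ is the subalgebra of $I_m(\mathcal{A})$ generated by $1$ and all operator traces $\mathrm{tr}(h)$. *)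

theory Defs
  imports
    "HOL-Analysis.Analysis"
    "HOL-Computational_Algebra.Polynomial"
    "HOL-Library.Poly_Mapping"
begin

text \<open>
  An \<open>n\<close>-dimensional algebra over a field with a fixed basis is given by a bilinear multiplication
  on the coordinate space \<^typ>\<open>'a ^ 'n\<close>; the fixed basis is \<open>axis i 1\<close>.
\<close>

type_synonym ('a, 'n) mult = "'a ^ 'n \<Rightarrow> 'a ^ 'n \<Rightarrow> 'a ^ 'n"

definition is_algebra :: "('a::field, 'n::finite) mult \<Rightarrow> bool" where
  "is_algebra A \<longleftrightarrow>
     (\<forall>a. Vector_Spaces.linear (*s) (*s) (\<lambda>b. A a b)) \<and>
     (\<forall>b. Vector_Spaces.linear (*s) (*s) (\<lambda>a. A a b))"

definition two_sided_ideal :: "('a::field, 'n::finite) mult \<Rightarrow> ('a ^ 'n) set \<Rightarrow> bool" where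
  "two_sided_ideal A I \<longleftrightarrow> vec.subspace I \<and> (\<forall>a. \<forall>x\<in>I. A a x \<in> I \<and> A x a \<in> I)"

definition simple_algebra :: "('a::field, 'n::finite) mult \<Rightarrow> bool" where
  "simple_algebra A \<longleftrightarrow>
     is_algebra A \<and> (\<exists>a b. A a b \<noteq> 0) \<and> (\<forall>I. two_sided_ideal A I \<longrightarrow> I = {0} \<or> I = UNIV)"

definition Aut :: "('a::field, 'n::finite) mult \<Rightarrow> ('a ^ 'n \<Rightarrow> 'a ^ 'n) set" where
  "Aut A = {g. Vector_Spaces.linear (*s) (*s) g \<and> bij g \<and> (\<forall>a b. g (A a b) = A (g a) (g b))}"

definition D3 :: "'a::field \<Rightarrow> 'a \<Rightarrow> ('a, 2) mult" where
  "D3 \<alpha> \<beta> a b =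
     (let e1 = axis 1 1; e2 = axis 2 1 in
        (a $ 1 * b $ 1) *s e1 + (a $ 1 * b $ 2) *s (e1 + \<alpha> *s e2)
        + (a $ 2 * b $ 1) *s (- e1 + \<beta> *s e2) + (a $ 2 * b $ 2) *s 0)"

text \<open>
  An \<open>m\<close>-tuple \<open>(a\<^sub>1, \<dots>, a\<^sub>m)\<close> is encoded as a sequence \<open>a :: nat \<Rightarrow> 'a ^ 'n\<close>, of which only the
  entries with index in \<open>{1..m}\<close> matter: every function in the sets \<open>poly_functions\<close>, \<open>invariants\<close>
  and \<open>Tr\<close> below depends on these entries only, so it is the same as a function on the \<open>m\<close>-th power
  of the algebra.
\<close>

inductive_set generated_subalgebra :: "('x \<Rightarrow> 'a::field) set \<Rightarrow> ('x \<Rightarrow> 'a) set"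
  for G :: "('x \<Rightarrow> 'a) set" where
  const: "(\<lambda>_. c) \<in> generated_subalgebra G"
| gen: "f \<in> G \<Longrightarrow> f \<in> generated_subalgebra G"
| add: "f \<in> generated_subalgebra G \<Longrightarrow> g \<in> generated_subalgebra G \<Longrightarrow>
        (\<lambda>a. f a + g a) \<in> generated_subalgebra G"
| mult: "f \<in> generated_subalgebra G \<Longrightarrow> g \<in> generated_subalgebra G \<Longrightarrow>
         (\<lambda>a. f a * g a) \<in> generated_subalgebra G"

definition poly_functions :: "nat \<Rightarrow> ((nat \<Rightarrow> 'a::field ^ 'n::finite) \<Rightarrow> 'a) set" where
  "poly_functions m = generated_subalgebra {(\<lambda>a. a r $ i) | r i. 1 \<le> r \<and> r \<le> m}"

definition invariants :: "nat \<Rightarrow> ('a::field, 'n::finite) mult \<Rightarrow> ((nat \<Rightarrow> 'a ^ 'n) \<Rightarrow> 'a) set" where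
  "invariants m A = {f \<in> poly_functions m. \<forall>g\<in>Aut A. \<forall>a. f (\<lambda>r. g (a r)) = f a}"

text \<open>
  Nonassociative monomials in the letters \<open>\<chi>\<^sub>0, \<chi>\<^sub>1, \<dots>\<close>. The absolutely free unital algebra has as basis
  the unit, represented by \<^term>\<open>None\<close>, together with all the nonempty monomials.
\<close>

datatype monomial = Letter nat | Prod monomial monomial

type_synonym 'a free_algebra = "monomial option \<Rightarrow>\<^sub>0 'a"

primrec letters :: "monomial \<Rightarrow> nat set" where
  "letters (Letter r) = {r}"
| "letters (Prod u v) = letters u \<union> letters v"

primrec degree0 :: "monomial \<Rightarrow> nat" where
  "degree0 (Letter r) = (if r = 0 then 1 else 0)"
| "degree0 (Prod u v) = degree0 u + degree0 v"

text \<open>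
  Elements of the free unital algebra on \<open>\<chi>\<^sub>0, \<dots>, \<chi>\<^sub>m\<close> that are homogeneous of degree 1 in \<open>\<chi>\<^sub>0\<close>.
  The unit has degree 0 in \<open>\<chi>\<^sub>0\<close>, so it does not occur in them.
\<close>

definition linear_in_chi0 :: "nat \<Rightarrow> 'a::field free_algebra \<Rightarrow> bool" where
  "linear_in_chi0 m h \<longleftrightarrow>
     (\<forall>w\<in>Poly_Mapping.keys h. \<exists>u. w = Some u \<and> letters u \<subseteq> {0..m} \<and> degree0 u = 1)"

primrec eval_monomial :: "('a::field, 'n::finite) mult \<Rightarrow> (nat \<Rightarrow> 'a ^ 'n) \<Rightarrow> monomial \<Rightarrow> 'a ^ 'n" where
  "eval_monomial A s (Letter r) = s r"
| "eval_monomial A s (Prod u v) = A (eval_monomial A s u) (eval_monomial A s v)"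

text \<open>
  The algebra need not have a unit; the value 0 chosen for the empty monomial is irrelevant, since
  \<open>substitute\<close> is used only for elements satisfying \<^const>\<open>linear_in_chi0\<close>.
\<close>

definition substitute :: "('a::field, 'n::finite) mult \<Rightarrow> 'a free_algebra \<Rightarrow> (nat \<Rightarrow> 'a ^ 'n) \<Rightarrow> 'a ^ 'n" where
  "substitute A h s =
     (\<Sum>w\<in>Poly_Mapping.keys h. Poly_Mapping.lookup h w *s
        (case w of None \<Rightarrow> 0 | Some u \<Rightarrow> eval_monomial A s u))"

definition operator_trace :: "('a::field, 'n::finite) mult \<Rightarrow> 'a free_algebra \<Rightarrow> (nat \<Rightarrow> 'a ^ 'n) \<Rightarrow> 'a" where
  "operator_trace A h a = trace (matrix (\<lambda>b. substitute A h (a(0 := b))))"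

text \<open>
  Operator traces are invariant polynomial functions, so generating inside \<^const>\<open>invariants\<close> or
  inside the algebra of all functions gives the same subalgebra.
\<close>

definition Tr :: "nat \<Rightarrow> ('a::field, 'n::finite) mult \<Rightarrow> ((nat \<Rightarrow> 'a ^ 'n) \<Rightarrow> 'a) set" where
  "Tr m A = generated_subalgebra {operator_trace A h | h. linear_in_chi0 m h}"

end

theory Submission
  imports Defs
begin

text \<open>
  The idea is to compare the two algebras in degree one. Once the automorphism group is known to be
  trivial, every polynomial function is invariant, so the degree one invariants of a single element
  \<open>a\<close> have dimension two. The operator traces of degree one in \<open>a\<close>, on the other hand, are spanned by
  the traces of the left and of the right multiplication by \<open>a\<close>, and the choice
  \<open>\<beta> = - \<alpha> - 2\<close> makes these proportional: they are \<open>t a\<close> and \<open>- t a\<close> for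
  \<open>t a = (1 + \<alpha>) a\<^sub>1 - a\<^sub>2\<close>. So the kernel of \<open>t\<close> contains the nonzero vector
  \<open>v = e\<^sub>1 + (1 + \<alpha>) e\<^sub>2\<close>, along which no operator trace has a linear term.

  This last property survives sums and products: if two polynomials in one variable have no linear
  term, neither does their product. It is therefore inherited by all of \<^const>\<open>Tr\<close>
  (lemma \<open>Tr_no_linear_term\<close>), whereas the first coordinate function restricts to the identity
  polynomial on the line through \<open>v\<close>. The line is infinite, so that polynomial is determined by the
  function, and the first coordinate is an invariant outside \<^const>\<open>Tr\<close>.

  Simplicity and rigidity are read off from the multiplication by \<open>e\<^sub>2\<close>, which has square zero. The
  products \<open>x e\<^sub>2\<close> and \<open>e\<^sub>2 x\<close> add up to \<open>- 2 x\<^sub>1 e\<^sub>2\<close>, so every nonzero ideal contains \<open>e\<^sub>2\<close>, and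
  then everything; and automorphisms preserve the line through \<open>e\<^sub>2\<close>, up to a factor that the product
  \<open>e\<^sub>1 e\<^sub>2\<close> shows to be one.
\<close>

section \<open>Operator traces along a line through the origin\<close>

primrec degree_pos :: "monomial \<Rightarrow> nat" where
  "degree_pos (Letter r) = (if r = 0 then 0 else 1)"
| "degree_pos (Prod u v) = degree_pos u + degree_pos v"

lemma degree_sum_pos: "degree0 u + degree_pos u > 0"
  by (induction u) auto

lemma is_algebra_scale:
  assumes "is_algebra A"
  shows "A (c *s x) y = c *s A x y" and "A x (c *s y) = c *s A x y"
proof -
  have "Vector_Spaces.linear (*s) (*s) (\<lambda>a. A a y)" "Vector_Spaces.linear (*s) (*s) (A x)"
    using assms by (simp_all add: is_algebra_def)
  then show "A (c *s x) y = c *s A x y" and "A x (c *s y) = c *s A x y"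
    using vec.linear_scale by blast+
qed

lemma eval_monomial_scale:
  assumes "is_algebra A"
  shows "eval_monomial A ((\<lambda>r. c *s a r)(0 := b)) u
    = c ^ degree_pos u *s eval_monomial A (a(0 := b)) u"
  by (induction u) (simp_all add: is_algebra_scale[OF assms] power_add mult.commute)

lemma trace_matrix: "trace (matrix f) = (\<Sum>i\<in>UNIV. f (axis i 1) $ i)"
  by (simp add: trace_def matrix_def)

text \<open>
  A monomial of bidegree \<open>(1, 1)\<close> has only two letters, hence is a left or a right multiplication.
\<close>

lemma trace_bidegree_1_1:
  fixes a :: "nat \<Rightarrow> 'a::field ^ 'n::finite"
  assumes L: "\<And>r. trace (matrix (\<lambda>b. A (a r) b)) = 0"
    and R: "\<And>r. trace (matrix (\<lambda>b. A b (a r))) = 0"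
    and "degree0 u = 1" "degree_pos u = 1"
  shows "trace (matrix (\<lambda>b. eval_monomial A (a(0 := b)) u)) = 0"
proof (cases u)
  case (Letter r)
  then have False using assms(3,4) by (cases "r = 0") simp_all
  then show ?thesis ..
next
  case (Prod x y)
  have letter: "\<exists>r. z = Letter r" if "degree0 z + degree_pos z = 1" for z
  proof (cases z)
    case (Prod p q)
    then show ?thesis
      using that degree_sum_pos[of p] degree_sum_pos[of q] by simp
  qed auto
  have "degree0 x + degree_pos x = 1" "degree0 y + degree_pos y = 1"
    using Prod assms(3,4) degree_sum_pos[of x] degree_sum_pos[of y] by auto
  then obtain r s where u: "u = Prod (Letter r) (Letter s)"
    using letter[of x] letter[of y] Prod by auto
  have "r = 0 \<and> s \<noteq> 0 \<or> r \<noteq> 0 \<and> s = 0"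
    using assms(3) unfolding u by (simp split: if_splits)
  then show ?thesis
    unfolding u using L[of r] R[of s] L[of s] R[of r] by auto
qed

text \<open>
  On the line through \<open>a\<close>, the trace of a single monomial \<open>u\<close> is a multiple of the power
  \<open>\<sigma> ^ degree_pos u\<close>, and for exponent one the factor is the trace of a left or of a right
  multiplication, which vanishes.
\<close>

lemma operator_trace_no_linear_term:
  fixes a :: "nat \<Rightarrow> 'a::field ^ 'n::finite"
  assumes A: "is_algebra A"
    and L: "\<And>r. trace (matrix (\<lambda>b. A (a r) b)) = 0"
    and R: "\<And>r. trace (matrix (\<lambda>b. A b (a r))) = 0"
    and h: "linear_in_chi0 m h"
  shows "\<exists>p. coeff p 1 = 0 \<and> (\<forall>\<sigma>. operator_trace A h (\<lambda>r. \<sigma> *s a r) = poly p \<sigma>)"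
proof -
  define T where "T u = trace (matrix (\<lambda>b. eval_monomial A (a(0 := b)) u))" for u
  define p where "p = (\<Sum>w\<in>Poly_Mapping.keys h.
    monom (Poly_Mapping.lookup h w * T (the w)) (degree_pos (the w)))"
  have key: "\<exists>u. w = Some u \<and> degree0 u = 1" if "w \<in> Poly_Mapping.keys h" for w
    using h that unfolding linear_in_chi0_def by blast
  have "T (the w) = 0" if "w \<in> Poly_Mapping.keys h" "degree_pos (the w) = 1" for w
    using key[OF that(1)] that(2) trace_bidegree_1_1[of A a, OF L R]
    by (auto simp: T_def)
  then have "coeff p 1 = 0"
    by (auto simp: p_def coeff_sum intro!: sum.neutral)
  moreover have "operator_trace A h (\<lambda>r. \<sigma> *s a r) = poly p \<sigma>" for \<sigma>
  proof -
    have monomial: "(case w of None \<Rightarrow> 0 | Some u \<Rightarrow> eval_monomial A ((\<lambda>r. \<sigma> *s a r)(0 := b)) u)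
        = \<sigma> ^ degree_pos (the w) *s eval_monomial A (a(0 := b)) (the w)"
      if "w \<in> Poly_Mapping.keys h" for w b
      using key[OF that] by (auto simp: eval_monomial_scale[OF A])
    have "substitute A h ((\<lambda>r. \<sigma> *s a r)(0 := b)) = (\<Sum>w\<in>Poly_Mapping.keys h.
        Poly_Mapping.lookup h w *s (\<sigma> ^ degree_pos (the w) *s eval_monomial A (a(0 := b)) (the w)))"
      for b
      unfolding substitute_def by (intro sum.cong refl) (simp only: monomial)
    then have "operator_trace A h (\<lambda>r. \<sigma> *s a r) = (\<Sum>i\<in>UNIV. \<Sum>w\<in>Poly_Mapping.keys h.
        Poly_Mapping.lookup h w * (\<sigma> ^ degree_pos (the w)
          * eval_monomial A (a(0 := axis i 1)) (the w) $ i))"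
      unfolding operator_trace_def trace_matrix
      by (simp only: sum_component vector_smult_component)
    also have "\<dots> = (\<Sum>w\<in>Poly_Mapping.keys h. \<Sum>i\<in>UNIV.
        Poly_Mapping.lookup h w * (\<sigma> ^ degree_pos (the w)
          * eval_monomial A (a(0 := axis i 1)) (the w) $ i))"
      by (rule sum.swap)
    also have "\<dots> = poly p \<sigma>"
      unfolding p_def poly_sum poly_monom T_def trace_matrix
      by (intro sum.cong refl) (simp only: sum_distrib_left[symmetric], simp only: mult_ac)
    finally show ?thesis .
  qed
  ultimately show ?thesis by blast
qed

lemma Tr_no_linear_term:
  fixes a :: "nat \<Rightarrow> 'a::field ^ 'n::finite"
  assumes A: "is_algebra A"
    and L: "\<And>r. trace (matrix (\<lambda>b. A (a r) b)) = 0"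
    and R: "\<And>r. trace (matrix (\<lambda>b. A b (a r))) = 0"
    and f: "f \<in> Tr m A"
  shows "\<exists>p. coeff p 1 = 0 \<and> (\<forall>\<sigma>. f (\<lambda>r. \<sigma> *s a r) = poly p \<sigma>)"
  using f unfolding Tr_def
proof (induction rule: generated_subalgebra.induct)
  case (const c)
  show ?case by (rule exI[of _ "[:c:]"]) simp
next
  case (gen f)
  then show ?case using operator_trace_no_linear_term[of A a, OF A L R] by blast
next
  case (add f g)
  then obtain p q where "coeff p 1 = 0" "\<forall>\<sigma>. f (\<lambda>r. \<sigma> *s a r) = poly p \<sigma>"
    "coeff q 1 = 0" "\<forall>\<sigma>. g (\<lambda>r. \<sigma> *s a r) = poly q \<sigma>" by blast
  then show ?case by (intro exI[of _ "p + q"]) simp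
next
  case (mult f g)
  then obtain p q where "coeff p 1 = 0" "\<forall>\<sigma>. f (\<lambda>r. \<sigma> *s a r) = poly p \<sigma>"
    "coeff q 1 = 0" "\<forall>\<sigma>. g (\<lambda>r. \<sigma> *s a r) = poly q \<sigma>" by blast
  then show ?case by (intro exI[of _ "p * q"]) (simp add: coeff_mult atMost_Suc)
qed

lemma coordinate_notin_Tr:
  fixes v :: "'a::{field, ring_char_0} ^ 'n::finite"
  assumes A: "is_algebra A"
    and L: "trace (matrix (\<lambda>b. A v b)) = 0" and R: "trace (matrix (\<lambda>b. A b v)) = 0"
    and v: "v $ i \<noteq> 0"
  shows "(\<lambda>a. a r $ i) \<notin> Tr m A"
proof
  assume "(\<lambda>a. a r $ i) \<in> Tr m A"
  then obtain p where p: "coeff p 1 = 0" "\<And>\<sigma>. \<sigma> * v $ i = poly p \<sigma>"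
    using Tr_no_linear_term[of A "\<lambda>_. v", OF A L R] by fastforce
  have "poly p = poly [:0, v $ i:]"
    using p(2) by (simp add: fun_eq_iff)
  then have "p = [:0, v $ i:]"
    by (simp only: poly_eq_poly_eq_iff)
  with p(1) v show False by simp
qed

section \<open>The algebra \<open>D3\<close>\<close>

lemma D3_nth [simp]:
  "D3 \<alpha> \<beta> a b $ 1 = a $ 1 * b $ 1 + a $ 1 * b $ 2 - a $ 2 * b $ 1"
  "D3 \<alpha> \<beta> a b $ 2 = \<alpha> * (a $ 1 * b $ 2) + \<beta> * (a $ 2 * b $ 1)"
  by (simp_all add: D3_def Let_def axis_def)

lemma vec2_eq_iff: "(x :: 'a ^ 2) = y \<longleftrightarrow> x $ 1 = y $ 1 \<and> x $ 2 = y $ 2"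
  by (simp add: vec_eq_iff forall_2)

lemma is_algebra_D3: "is_algebra (D3 \<alpha> \<beta>)"
  unfolding is_algebra_def
  by (auto simp: Vector_Spaces.linear_iff vec.vector_space_axioms vec2_eq_iff algebra_simps)

lemma axis_2_nth [simp]:
  "(axis 1 c :: 'a::zero ^ 2) $ 1 = c" "(axis 1 c :: 'a ^ 2) $ 2 = 0"
  "(axis 2 c :: 'a ^ 2) $ 1 = 0" "(axis 2 c :: 'a ^ 2) $ 2 = c"
  by (simp_all add: axis_def)

lemma trace_D3:
  "trace (matrix (\<lambda>b. D3 \<alpha> \<beta> a b)) = (1 + \<alpha>) * a $ 1 - a $ 2"
  "trace (matrix (\<lambda>b. D3 \<alpha> \<beta> b a)) = (1 + \<beta>) * a $ 1 + a $ 2"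
  by (simp_all add: trace_matrix sum_2 algebra_simps)

lemma vec2_basis: "(x :: 'a::field ^ 2) = x $ 1 *s axis 1 1 + x $ 2 *s axis 2 1"
  by (simp add: vec2_eq_iff)

text \<open>
  The second basis vector generates the first through \<open>e\<^sub>1 e\<^sub>2 = e\<^sub>1 + \<alpha> e\<^sub>2\<close>, so it suffices to find
  it in every nonzero ideal.
\<close>

lemma simple_algebra_D3:
  fixes \<alpha> \<beta> :: "'a::field"
  assumes "\<alpha> + \<beta> \<noteq> 0"
  shows "simple_algebra (D3 \<alpha> \<beta>)"
proof -
  define e1 e2 :: "'a ^ 2" where "e1 = axis 1 1" and "e2 = axis 2 1"
  have "D3 \<alpha> \<beta> e1 e1 \<noteq> 0"
    by (simp add: vec2_eq_iff e1_def)
  moreover have "I = UNIV" if I: "two_sided_ideal (D3 \<alpha> \<beta>) I" and "I \<noteq> {0}" for I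
  proof -
    have sub: "vec.subspace I" and prod: "\<And>a x. x \<in> I \<Longrightarrow> D3 \<alpha> \<beta> a x \<in> I"
      "\<And>a x. x \<in> I \<Longrightarrow> D3 \<alpha> \<beta> x a \<in> I"
      using I by (auto simp: two_sided_ideal_def)
    obtain x where x: "x \<in> I" "x \<noteq> 0"
      using \<open>I \<noteq> {0}\<close> vec.subspace_0[OF sub] by blast
    have "\<exists>c. c \<noteq> 0 \<and> c *s e2 \<in> I"
    proof (cases "x $ 1 = 0")
      case True
      then have "x = x $ 2 *s e2" "x $ 2 \<noteq> 0"
        using x(2) by (auto simp: vec2_eq_iff e2_def)
      then show ?thesis using x(1) by metis
    next
      case False
      have "D3 \<alpha> \<beta> x e2 + D3 \<alpha> \<beta> e2 x = ((\<alpha> + \<beta>) * x $ 1) *s e2"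
        by (simp add: vec2_eq_iff e2_def algebra_simps)
      then have "((\<alpha> + \<beta>) * x $ 1) *s e2 \<in> I"
        using vec.subspace_add[OF sub prod(2)[OF x(1)] prod(1)[OF x(1)]] by metis
      then show ?thesis using False assms by (meson mult_eq_0_iff)
    qed
    then obtain c where c: "c \<noteq> 0" "c *s e2 \<in> I" by blast
    have "e2 = inverse c *s (c *s e2)" using c(1) by simp
    then have e2: "e2 \<in> I"
      using vec.subspace_scale[OF sub c(2)] by metis
    have "e1 = D3 \<alpha> \<beta> e1 e2 - \<alpha> *s e2"
      by (simp add: vec2_eq_iff e1_def e2_def)
    then have "e1 \<in> I"
      using vec.subspace_diff[OF sub prod(1)[OF e2] vec.subspace_scale[OF sub e2]] by metis
    then have "y \<in> I" for y
      using vec2_basis[of y, folded e1_def e2_def] e2 vec.subspace_add[OF sub]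
        vec.subspace_scale[OF sub] by metis
    then show ?thesis by blast
  qed
  ultimately show ?thesis
    unfolding simple_algebra_def using is_algebra_D3 by blast
qed

text \<open>
  An automorphism maps the line spanned by \<open>e\<^sub>2\<close> to itself, because it consists of the elements of square zero,
  and it sends \<open>e\<^sub>1\<close> to an idempotent outside that line, hence to some \<open>e\<^sub>1 + d e\<^sub>2\<close>. If it sends
  \<open>e\<^sub>2\<close> to \<open>q e\<^sub>2\<close>, then the image of \<open>e\<^sub>1 e\<^sub>2 = e\<^sub>1 + \<alpha> e\<^sub>2\<close> gives
  \<open>q (e\<^sub>1 + \<alpha> e\<^sub>2) = e\<^sub>1 + (d + \<alpha> q) e\<^sub>2\<close>, which forces \<open>q = 1\<close> and \<open>d = 0\<close>.
\<close>

lemma Aut_D3: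
  fixes \<alpha> \<beta> :: "'a::field"
  shows "Aut (D3 \<alpha> \<beta>) = {id}"
proof -
  define e1 e2 :: "'a ^ 2" where "e1 = axis 1 1" and "e2 = axis 2 1"
  have "g = id" if "g \<in> Aut (D3 \<alpha> \<beta>)" for g
  proof -
    have lin: "Vector_Spaces.linear (*s) (*s) g" and "inj g"
      and hom: "\<And>a b. g (D3 \<alpha> \<beta> a b) = D3 \<alpha> \<beta> (g a) (g b)"
      using that by (auto simp: Aut_def bij_def)
    have g0: "g 0 = 0" using vec.linear_0[OF lin] .
    have "D3 \<alpha> \<beta> e2 e2 = 0" "D3 \<alpha> \<beta> e1 e1 = e1" "D3 \<alpha> \<beta> e1 e2 = e1 + \<alpha> *s e2"
      by (simp_all add: vec2_eq_iff e1_def e2_def)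
    then have sq2: "D3 \<alpha> \<beta> (g e2) (g e2) = 0" and sq1: "D3 \<alpha> \<beta> (g e1) (g e1) = g e1"
      and e12: "D3 \<alpha> \<beta> (g e1) (g e2) = g e1 + \<alpha> *s g e2"
      using hom[of e2 e2] hom[of e1 e1] hom[of e1 e2] g0
      by (simp_all add: vec.linear_add[OF lin] vec.linear_scale[OF lin])
    have p: "g e2 $ 1 = 0"
      using sq2 by (simp add: vec2_eq_iff)
    have c: "g e1 $ 1 = 1"
    proof -
      have "g e1 $ 1 \<noteq> 0"
      proof
        assume "g e1 $ 1 = 0"
        then have "g e1 = 0"
          using sq1 by (simp add: vec2_eq_iff)
        then have "e1 = 0" using g0 \<open>inj g\<close> by (metis injD)
        then show False by (simp add: e1_def vec2_eq_iff)
      qed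
      then show ?thesis using sq1 by (simp add: vec2_eq_iff)
    qed
    have q: "g e2 $ 2 = 1" and d: "g e1 $ 2 = 0"
      using e12 c p by (simp_all add: vec2_eq_iff)
    have basis: "g e1 = e1" "g e2 = e2"
      using c d p q by (simp_all add: vec2_eq_iff e1_def e2_def)
    show ?thesis
    proof
      fix x :: "'a ^ 2"
      have "g (x $ 1 *s e1 + x $ 2 *s e2) = x $ 1 *s e1 + x $ 2 *s e2"
        by (simp add: vec.linear_add[OF lin] vec.linear_scale[OF lin] basis)
      then show "g x = id x"
        using vec2_basis[of x, folded e1_def e2_def] by simp
    qed
  qed
  moreover have "id \<in> Aut (D3 \<alpha> \<beta>)"
    by (simp add: Aut_def vec.linear_id)
  ultimately show ?thesis by blast
qed

theorem lemma7p11: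
  fixes \<alpha> :: "'a::{alg_closed_field, field_char_0}"
  shows "simple_algebra (D3 \<alpha> (- \<alpha> - 2))
    \<and> Aut (D3 \<alpha> (- \<alpha> - 2)) = {id}
    \<and> (\<forall>m>0. invariants m (D3 \<alpha> (- \<alpha> - 2)) \<noteq> Tr m (D3 \<alpha> (- \<alpha> - 2)))"
proof (intro conjI allI impI)
  show "simple_algebra (D3 \<alpha> (- \<alpha> - 2))"
    by (rule simple_algebra_D3) simp
  show aut: "Aut (D3 \<alpha> (- \<alpha> - 2)) = {id}"
    by (rule Aut_D3)
  fix m :: nat
  assume "m > 0"
  let ?f = "\<lambda>a :: nat \<Rightarrow> 'a ^ 2. a 1 $ 1"
  have "?f \<in> poly_functions m"
    unfolding poly_functions_def using \<open>m > 0\<close>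
    by (intro generated_subalgebra.gen CollectI exI[of _ 1]) auto
  then have "?f \<in> invariants m (D3 \<alpha> (- \<alpha> - 2))"
    by (simp add: invariants_def aut)
  moreover have "?f \<notin> Tr m (D3 \<alpha> (- \<alpha> - 2))"
  proof (rule coordinate_notin_Tr[OF is_algebra_D3])
    \<comment> \<open>A vector spanning the common kernel of the traces of left and right multiplication.\<close>
    let ?v = "axis 1 1 + (1 + \<alpha>) *s axis 2 1 :: 'a ^ 2"
    show "trace (matrix (\<lambda>b. D3 \<alpha> (- \<alpha> - 2) ?v b)) = 0"
      and "trace (matrix (\<lambda>b. D3 \<alpha> (- \<alpha> - 2) b ?v)) = 0"
      by (simp_all add: trace_D3 algebra_simps)
    show "?v $ 1 \<noteq> 0" by simp
  qed
  ultimately show "invariants m (D3 \<alpha> (- \<alpha> - 2)) \<noteq> Tr m (D3 \<alpha> (- \<alpha> - 2))" by blast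
qed

end
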